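(* Let $\alpha,\beta\ge 0$, $M\ge 1$, $s\ge 0$, let $(X,d)$ be an $(\alpha,\beta)$-almost $(M,s)$-homogeneous metric space and let $H$ be an infinite-dimensional separable Hilbert space. Then, for every $\gamma>\alpha+\beta+\frac12$, there exist a map $f:X\to H$ and a constant $L>0$ such that $$\frac1L\,\frac{d(x,y)}{\operatorname{slog}(d(x,y))^{\gamma}}\le \|f(x)-f(y)\|\le L\,d(x,y)$$ for all $x,y\in X$ with $x\ne y$; i.e. $f$ is $\gamma$-almost bi-Lipschitz.
   Context: For $x>0$, $\operatorname{slog}(x):=\log(x+x^{-1})$. For a metric space $(X,d)$ and $0<\rho<r$, $\mathcal N_X(r,\rho)$ denotes the minimum number of balls of radius $\rho$ sufficient to cover any ball of radius $r$ in $X$. For $\alpha,\beta\ge0$, $M\ge 1$, $s\ge 0$, the space $(X,d)$ is $(\alpha,\beta)$-almost $(M,s)$-homogeneous if $\mathcal N_X(r,\rho)\le M\left(\frac r\rho\right)^s\operatorname{slog}(r)^\beta\operatorname{slog}(\rho)^\alpha$ for all $0<\rho<r<\infty$. *)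

theory Defs
  imports "HOL-Analysis.Analysis"
begin

definition slog :: "real \<Rightarrow> real" where
  "slog x = ln (x + inverse x)"

context Metric_space
begin

text \<open>Balls are open and centred in the space, and one number \<open>n\<close> has to work for all balls of
  radius \<open>r\<close>. The value is \<open>\<infinity>\<close> if no finite number of balls suffices.\<close>

definition cover_num :: "real \<Rightarrow> real \<Rightarrow> enat" where
  "cover_num r \<rho> = Inf {enat n | n. \<forall>x\<in>M. \<exists>C\<subseteq>M. finite C \<and> card C \<le> n \<and>
                                       mball x r \<subseteq> (\<Union>c\<in>C. mball c \<rho>)}"

text \<open>The carrier of the space is called \<open>M\<close> in the locale \<^locale>\<open>Metric_space\<close>; the
  constant of homogeneity is \<open>K\<close> here.\<close>

definition almost_homogeneous :: "real \<Rightarrow> real \<Rightarrow> real \<Rightarrow> real \<Rightarrow> bool" where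
  "almost_homogeneous \<alpha> \<beta> K s \<longleftrightarrow>
     (\<forall>r \<rho>. 0 < \<rho> \<and> \<rho> < r \<longrightarrow>
        ereal_of_enat (cover_num r \<rho>)
          \<le> ereal (K * (r / \<rho>) powr s * slog r powr \<beta> * slog \<rho> powr \<alpha>))"

end

definition infinite_dimensional :: "'h::real_vector itself \<Rightarrow> bool" where
  "infinite_dimensional _ \<longleftrightarrow> \<not> (\<exists>B :: 'h set. finite B \<and> span B = UNIV)"

end

theory Submission
  imports Defs
begin

text \<open>The map records, at every dyadic scale, the distances to the nearby points of a net, and
  gives each net point of each scale its own orthonormal direction in \<open>H\<close>.

  For each integer \<open>j\<close> fix a maximal \<open>2\<^sup>j\<close>-separated set \<open>N\<^sub>j\<close>. A net point \<open>a \<in> N\<^sub>j\<close> contributes the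
  coordinate \<open>(2 + \<bar>j\<bar>) powr (-\<gamma>) * max 0 (2 * 2\<^sup>j - d x a)\<close>, a weighted tent of height \<open>2 * 2\<^sup>j\<close> around
  \<open>a\<close>. By almost homogeneity each \<open>N\<^sub>j\<close> is countable, so there are countably many coordinates, and an
  orthonormal sequence of \<open>H\<close> can carry all of them. Since distances between images only
  involve differences of coordinates, what has to be square summable is the family of differences
  for two points \<open>x, y\<close>, not the family of values (which grows at coarse scales); fixing a base
  point turns this into a map (\<open>hilbert_embedding_from_coordinates\<close>).

  Upper bound. Each tent is 1-Lipschitz, and by almost homogeneity at most
  \<open>C * (2 + \<bar>j\<bar>) powr (\<alpha> + \<beta>)\<close> tents of scale \<open>j\<close> are nonzero at a given point
  (\<open>dyadic_net_multiplicity\<close>). Hence the squared distance of the images is at most a constant times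
  \<open>(d x y)\<^sup>2\<close> times the sum over \<open>j\<close> of \<open>(2 + \<bar>j\<bar>) powr (\<alpha> + \<beta> - 2 * \<gamma>)\<close>, which converges because
  \<open>2 * \<gamma> - \<alpha> - \<beta> > \<alpha> + \<beta> + 1 \<ge> 1\<close>.

  Lower bound. A single coordinate is enough. Take \<open>j\<close> with \<open>4 * 2\<^sup>j \<le> d x y < 8 * 2\<^sup>j\<close> and a net
  point \<open>a \<in> N\<^sub>j\<close> within \<open>2\<^sup>j\<close> of \<open>x\<close>. Its tent is at least \<open>2\<^sup>j\<close> at \<open>x\<close> and zero at \<open>y\<close>, so the images
  are at least \<open>(2 + \<bar>j\<bar>) powr (-\<gamma>) * 2\<^sup>j\<close> apart, and \<open>2 + \<bar>j\<bar>\<close> is at most a constant times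
  \<open>slog (d x y)\<close> (\<open>dyadic_scale\<close>).\<close>

section \<open>Orthonormal coordinates in a Hilbert space\<close>

text \<open>Pythagoras for finite blocks makes the partial sums Cauchy and passes to the limit. Completeness
  enters through \<open>Cauchy_convergent\<close>: the sort \<open>{real_inner, complete_space}\<close> does not imply the class
  \<open>banach\<close>, so the Cauchy criterion for vector-valued series does not apply directly.\<close>

lemma summable_orthonormal_series:
  fixes e :: "nat \<Rightarrow> 'h::{real_inner, complete_space}" and c :: "nat \<Rightarrow> real"
  assumes e: "\<And>m n. e m \<bullet> e n = (if m = n then 1 else 0)"
    and c: "summable (\<lambda>n. (c n)\<^sup>2)"
  shows "summable (\<lambda>n. c n *\<^sub>R e n)"
    and "(norm (\<Sum>n. c n *\<^sub>R e n))\<^sup>2 = (\<Sum>n. (c n)\<^sup>2)"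
proof -
  have pyth: "(norm (\<Sum>n\<in>A. c n *\<^sub>R e n))\<^sup>2 = (\<Sum>n\<in>A. (c n)\<^sup>2)" if "finite A" for A
  proof -
    have "(norm (\<Sum>n\<in>A. c n *\<^sub>R e n))\<^sup>2 = (\<Sum>n\<in>A. (norm (c n *\<^sub>R e n))\<^sup>2)"
      using that by (intro norm_sum_Pythagorean) (auto simp: pairwise_def orthogonal_def e)
    then show ?thesis
      by (simp add: power_mult_distrib power2_norm_eq_inner e)
  qed
  have "Cauchy (\<lambda>n. \<Sum>k<n. c k *\<^sub>R e k)"
    unfolding Cauchy_altdef
  proof (intro allI impI)
    fix \<epsilon> :: real assume "\<epsilon> > 0"
    then obtain N where N: "\<And>m n. m \<ge> N \<Longrightarrow> norm (\<Sum>k\<in>{m..<n}. (c k)\<^sup>2) < \<epsilon>\<^sup>2"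
      using c unfolding summable_Cauchy by (metis zero_less_power)
    have "dist (\<Sum>k<m. c k *\<^sub>R e k) (\<Sum>k<n. c k *\<^sub>R e k) < \<epsilon>" if "m \<ge> N" "n > m" for m n
    proof (rule power2_less_imp_less)
      have "(\<Sum>k<n. c k *\<^sub>R e k) = (\<Sum>k<m. c k *\<^sub>R e k) + (\<Sum>k\<in>{m..<n}. c k *\<^sub>R e k)"
        using \<open>n > m\<close> by (simp add: lessThan_atLeast0 sum.atLeastLessThan_concat)
      then have "dist (\<Sum>k<m. c k *\<^sub>R e k) (\<Sum>k<n. c k *\<^sub>R e k)
          = norm (\<Sum>k\<in>{m..<n}. c k *\<^sub>R e k)"
        by (simp add: dist_norm)
      then show "(dist (\<Sum>k<m. c k *\<^sub>R e k) (\<Sum>k<n. c k *\<^sub>R e k))\<^sup>2 < \<epsilon>\<^sup>2"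
        using N[OF that(1), of n] pyth[of "{m..<n}"] by (simp add: sum_nonneg)
    qed (use \<open>\<epsilon> > 0\<close> in simp)
    then show "\<exists>N. \<forall>m\<ge>N. \<forall>n>m. dist (\<Sum>k<m. c k *\<^sub>R e k) (\<Sum>k<n. c k *\<^sub>R e k) < \<epsilon>"
      by blast
  qed
  then show s: "summable (\<lambda>n. c n *\<^sub>R e n)"
    unfolding summable_iff_convergent by (rule Cauchy_convergent)
  have "(\<lambda>n. (norm (\<Sum>k<n. c k *\<^sub>R e k))\<^sup>2) \<longlonglongrightarrow> (norm (\<Sum>n. c n *\<^sub>R e n))\<^sup>2"
    by (intro tendsto_intros summable_LIMSEQ s)
  then show "(norm (\<Sum>n. c n *\<^sub>R e n))\<^sup>2 = (\<Sum>n. (c n)\<^sup>2)"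
    using summable_LIMSEQ[OF c] by (simp add: pyth LIMSEQ_unique)
qed

text \<open>A maximal orthonormal set is infinite: if it were finite, subtracting from a vector outside its
  span its projection onto the span would leave a nonzero vector by which the set could be
  enlarged.\<close>

lemma infinite_dimensional_orthonormal_sequence:
  assumes "infinite_dimensional TYPE('h::real_inner)"
  obtains e :: "nat \<Rightarrow> 'h::real_inner" where "\<And>m n. e m \<bullet> e n = (if m = n then 1 else 0)"
proof -
  define on :: "'h set \<Rightarrow> bool"
    where "on B \<longleftrightarrow> (\<forall>u\<in>B. \<forall>v\<in>B. u \<bullet> v = (if u = v then 1 else 0))" for B
  have "\<exists>B\<in>Collect on. \<forall>C\<in>Collect on. B \<subseteq> C \<longrightarrow> C = B"
  proof (rule subset_Zorn')
    fix \<C> assume ch: "subset.chain (Collect on) \<C>"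
    have "u \<bullet> v = (if u = v then 1 else 0)" if uv: "u \<in> \<Union>\<C>" "v \<in> \<Union>\<C>" for u v
    proof -
      obtain S T where "S \<in> \<C>" "T \<in> \<C>" "u \<in> S" "v \<in> T" using uv by blast
      moreover have "S \<subseteq> T \<or> T \<subseteq> S"
        using ch calculation by (auto simp: subset_chain_def)
      moreover have "on S" "on T"
        using ch calculation by (auto simp: subset_chain_def)
      ultimately show ?thesis unfolding on_def by blast
    qed
    then show "\<Union>\<C> \<in> Collect on" by (simp add: on_def)
  qed
  then obtain B where B: "on B" and maxB: "\<And>C. on C \<Longrightarrow> B \<subseteq> C \<Longrightarrow> C = B" by blast
  have "infinite B"
  proof
    assume fin: "finite B"
    then obtain v where v: "v \<notin> span B"
      using assms unfolding infinite_dimensional_def by blast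
    define w where "w = v - (\<Sum>b\<in>B. (v \<bullet> b) *\<^sub>R b)"
    have "(\<Sum>b\<in>B. (v \<bullet> b) *\<^sub>R b) \<in> span B"
      by (intro span_sum span_scale span_base)
    then have "w \<noteq> 0" using v by (auto simp: w_def)
    have orth: "w \<bullet> b = 0" if "b \<in> B" for b
    proof -
      have "(\<Sum>b'\<in>B. (v \<bullet> b') * (b' \<bullet> b)) = (\<Sum>b'\<in>B. if b' = b then v \<bullet> b' else 0)"
        using B that by (intro sum.cong) (auto simp: on_def)
      then show ?thesis
        using fin that by (simp add: w_def inner_diff_left inner_sum_left sum.delta)
    qed
    define u where "u = w /\<^sub>R norm w"
    have u: "u \<bullet> u = 1"
      using \<open>w \<noteq> 0\<close> by (simp add: u_def dot_square_norm power2_eq_square)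
    have ub: "u \<bullet> b = 0" "b \<bullet> u = 0" if "b \<in> B" for b
      using orth[OF that] by (auto simp: u_def inner_commute)
    have "u \<notin> B" using u ub(1)[of u] by auto
    moreover have "on (insert u B)"
      using B u ub \<open>u \<notin> B\<close> by (auto simp: on_def)
    ultimately show False using maxB[of "insert u B"] by blast
  qed
  then obtain e :: "nat \<Rightarrow> 'h" where "inj e" "range e \<subseteq> B"
    using infinite_countable_subset by blast
  then have "e m \<bullet> e n = (if m = n then 1 else 0)" for m n
    using B rangeI[of e] unfolding on_def by (metis inj_eq subsetD)
  then show ?thesis by (rule that)
qed

text \<open>The coordinates \<open>g i x\<close> themselves need not be square summable, only their differences; the map is
  therefore the series of the differences to a base point \<open>x\<^sub>0\<close>, which cancels in \<open>f x - f y\<close>.\<close>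

lemma hilbert_embedding_from_coordinates:
  fixes g :: "'i \<Rightarrow> 'a \<Rightarrow> real" and D :: "'a \<Rightarrow> 'a \<Rightarrow> real"
  assumes inf: "infinite_dimensional TYPE('h::{real_inner, complete_space})"
    and I: "countable I"
    and bound: "\<And>x y F. \<lbrakk>x \<in> X; y \<in> X; finite F; F \<subseteq> I\<rbrakk>
                  \<Longrightarrow> (\<Sum>i\<in>F. (g i x - g i y)\<^sup>2) \<le> D x y"
  shows "\<exists>f :: 'a \<Rightarrow> 'h::{real_inner, complete_space}. \<forall>x\<in>X. \<forall>y\<in>X.
           (norm (f x - f y))\<^sup>2 \<le> D x y \<and> (\<forall>i\<in>I. \<bar>g i x - g i y\<bar> \<le> norm (f x - f y))"
proof (cases "X = {}")
  case True
  then show ?thesis by blast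
next
  case False
  then obtain x0 where x0: "x0 \<in> X" by blast
  obtain e :: "nat \<Rightarrow> 'h" where e: "\<And>m n. e m \<bullet> e n = (if m = n then 1 else 0)"
    using infinite_dimensional_orthonormal_sequence[OF inf] by blast
  define \<iota> where "\<iota> = to_nat_on I"
  have inj: "inj_on \<iota> I" using I by (simp add: \<iota>_def inj_on_to_nat_on)
  \<comment> \<open>Basis directions that are not the index of any coordinate receive the coefficient 0.\<close>
  define c where "c x y n = (if n \<in> \<iota> ` I then g (the_inv_into I \<iota> n) x - g (the_inv_into I \<iota> n) y
                               else 0)" for x y n
  have c_index: "c x y (\<iota> i) = g i x - g i y" if "i \<in> I" for x y i
    using that inj by (simp add: c_def the_inv_into_f_f)
  have c_partial: "(\<Sum>n<N. (c x y n)\<^sup>2) \<le> D x y" if "x \<in> X" "y \<in> X" for x y N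
  proof -
    define F where "F = {i \<in> I. \<iota> i < N}"
    have injF: "inj_on \<iota> F" using inj by (rule inj_on_subset) (auto simp: F_def)
    have img: "\<iota> ` F \<subseteq> {..<N}" by (auto simp: F_def)
    then have fin: "finite F" using injF by (meson finite_lessThan finite_subset finite_imageD)
    have "(\<Sum>n<N. (c x y n)\<^sup>2) = (\<Sum>n\<in>\<iota> ` F. (c x y n)\<^sup>2)"
      by (intro sum.mono_neutral_right img) (auto simp: F_def c_def)
    also have "\<dots> = (\<Sum>i\<in>F. (g i x - g i y)\<^sup>2)"
      using injF by (subst sum.reindex) (auto simp: F_def c_index intro!: sum.cong)
    also have "\<dots> \<le> D x y"
      using that fin by (intro bound) (auto simp: F_def)
    finally show ?thesis .
  qed
  have c_summable: "summable (\<lambda>n. (c x y n)\<^sup>2)" if "x \<in> X" "y \<in> X" for x y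
    using c_partial[OF that] by (intro summableI_nonneg_bounded) auto
  define f where "f x = (\<Sum>n. c x x0 n *\<^sub>R e n)" for x
  have norm_f: "(norm (f x - f y))\<^sup>2 = (\<Sum>n. (c x y n)\<^sup>2)" if "x \<in> X" "y \<in> X" for x y
  proof -
    have "f x - f y = (\<Sum>n. c x x0 n *\<^sub>R e n - c y x0 n *\<^sub>R e n)"
      unfolding f_def using that x0
      by (intro suminf_diff summable_orthonormal_series(1)[OF e] c_summable)
    also have "(\<lambda>n. c x x0 n *\<^sub>R e n - c y x0 n *\<^sub>R e n) = (\<lambda>n. c x y n *\<^sub>R e n)"
      by (auto simp: c_def algebra_simps)
    finally show ?thesis
      using summable_orthonormal_series(2)[OF e c_summable[OF that]] by simp
  qed
  show ?thesis
  proof (intro exI[of _ f] ballI conjI)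
    fix x y assume xy: "x \<in> X" "y \<in> X"
    show "(norm (f x - f y))\<^sup>2 \<le> D x y"
      using norm_f[OF xy] suminf_le_const[OF c_summable[OF xy] c_partial[OF xy]] by simp
    fix i assume i: "i \<in> I"
    have "(\<Sum>n\<in>{\<iota> i}. (c x y n)\<^sup>2) \<le> (\<Sum>n. (c x y n)\<^sup>2)"
      by (intro sum_le_suminf c_summable xy) auto
    then have "\<bar>g i x - g i y\<bar>\<^sup>2 \<le> (norm (f x - f y))\<^sup>2"
      using c_index[OF i] norm_f[OF xy] by simp
    then show "\<bar>g i x - g i y\<bar> \<le> norm (f x - f y)"
      by (rule power2_le_imp_le) simp
  qed
qed

section \<open>The symmetric logarithm at dyadic scales\<close>

lemma slog_lower_bounds:
  assumes "x > 0"
  shows "ln 2 \<le> slog x" and "\<bar>ln x\<bar> \<le> slog x"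
proof -
  have "0 \<le> (x - 1)\<^sup>2" by simp
  then have "2 \<le> x + inverse x"
    using assms by (simp add: field_simps power2_eq_square)
  then show "ln 2 \<le> slog x"
    unfolding slog_def by (subst ln_le_cancel_iff) auto
  have "ln x \<le> slog x" "ln (inverse x) \<le> slog x"
    unfolding slog_def using assms by (auto intro!: ln_mono add_pos_pos)
  then show "\<bar>ln x\<bar> \<le> slog x"
    using assms by (simp add: ln_inverse abs_le_iff)
qed

lemma slog_two_powr_le: "slog (2 powr t) \<le> 1 + \<bar>t\<bar>"
proof -
  have "slog (2 powr t) = ln (2 powr t + 2 powr (- t))"
    by (simp add: slog_def powr_minus)
  also have "\<dots> \<le> ln (2 * 2 powr \<bar>t\<bar>)"
  proof (rule ln_mono)
    have "2 powr t \<le> 2 powr \<bar>t\<bar>" "2 powr (- t) \<le> (2::real) powr \<bar>t\<bar>"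
      by (auto intro: powr_mono)
    then show "2 powr t + 2 powr - t \<le> 2 * 2 powr \<bar>t\<bar>" by linarith
  qed (auto intro: add_pos_pos)
  also have "\<dots> = ln 2 * (1 + \<bar>t\<bar>)"
    by (simp add: ln_mult ln_powr algebra_simps)
  also have "\<dots> \<le> 1 * (1 + \<bar>t\<bar>)"
    using ln_le_minus_one[of 2] by (intro mult_right_mono) auto
  finally show ?thesis by simp
qed

text \<open>Choosing \<open>j\<close> smaller by 2 than the dyadic exponent of \<open>t\<close> leaves room in the lower bound: a net point within \<open>2\<^sup>j\<close> of one of two
  points at distance at least \<open>4 * 2\<^sup>j\<close> is farther than \<open>2 * 2\<^sup>j\<close> from the other. The constant 6 in the
  last conclusion comes from \<open>\<bar>j\<bar> \<le> 3 + slog t / ln 2\<close> and \<open>1 \<le> slog t / ln 2\<close>, which bounds the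
  constant part \<open>2 + 3\<close> as well.\<close>

lemma dyadic_scale:
  assumes "t > 0"
  obtains j :: int where "4 * 2 powr j \<le> t" "t < 8 * 2 powr j"
    and "2 + \<bar>real_of_int j\<bar> \<le> 6 / ln 2 * slog t"
proof -
  define j where "j = \<lfloor>log 2 t\<rfloor> - 2"
  have j: "2 + real_of_int j \<le> log 2 t" "log 2 t < 3 + real_of_int j"
    unfolding j_def by linarith+
  have "2 powr (2 + real_of_int j) \<le> t" "t < 2 powr (3 + real_of_int j)"
    using j assms by (auto simp: le_log_iff log_less_iff)
  then have t: "4 * 2 powr j \<le> t" "t < 8 * 2 powr j"
    by (simp_all add: powr_add)
  have "\<bar>log 2 t\<bar> = \<bar>ln t\<bar> / ln 2" by (simp add: log_def abs_divide)
  also have "\<dots> \<le> slog t / ln 2"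
    using slog_lower_bounds(2)[OF assms] by (simp add: divide_right_mono)
  finally have "\<bar>j\<bar> \<le> 3 + slog t / ln 2" using j by linarith
  moreover have "1 \<le> slog t / ln 2"
    using slog_lower_bounds(1)[OF assms] by simp
  ultimately have "2 + \<bar>real_of_int j\<bar> \<le> 6 * (slog t / ln 2)" by linarith
  with t show ?thesis by (intro that[of j]) auto
qed

text \<open>The absolute value is injective on each of the two halves of the integers, so each half of the sum
  is bounded by the convergent series over the natural numbers.\<close>

lemma sum_int_powr_bounded:
  fixes p :: real
  assumes "p > 1"
  shows "\<exists>B. \<forall>J :: int set. finite J \<longrightarrow> (\<Sum>j\<in>J. (2 + \<bar>real_of_int j\<bar>) powr (- p)) \<le> B"
proof -
  define h :: "nat \<Rightarrow> real" where "h n = (2 + n) powr (- p)" for n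
  have "h = (\<lambda>n. real (n + 2) powr (- p))"
    by (rule ext) (simp only: h_def of_nat_add of_nat_numeral add.commute)
  moreover have "summable (\<lambda>n. real n powr (- p))"
    using assms by (simp add: summable_real_powr_iff)
  then have "summable (\<lambda>n. real (n + 2) powr (- p))"
    by (rule summable_ignore_initial_segment)
  ultimately have h: "summable h" by (simp only:)
  show ?thesis
  proof (intro exI[of _ "2 * suminf h"] allI impI)
    fix J :: "int set" assume J: "finite J"
    have half: "(\<Sum>j\<in>J'. (2 + \<bar>real_of_int j\<bar>) powr (- p)) \<le> suminf h"
      if "J' \<subseteq> J" and inj: "inj_on (\<lambda>j. nat \<bar>j\<bar>) J'" for J'
    proof -
      have "(\<Sum>j\<in>J'. (2 + \<bar>real_of_int j\<bar>) powr (- p)) = (\<Sum>n\<in>(\<lambda>j. nat \<bar>j\<bar>) ` J'. h n)"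
        using inj by (simp add: sum.reindex h_def)
      also have "\<dots> \<le> suminf h"
      proof (rule sum_le_suminf[OF h])
        show "finite ((\<lambda>j. nat \<bar>j\<bar>) ` J')"
          using J \<open>J' \<subseteq> J\<close> by (meson finite_imageI finite_subset)
      qed (simp add: h_def)
      finally show ?thesis .
    qed
    have "(\<Sum>j\<in>J. (2 + \<bar>real_of_int j\<bar>) powr (- p))
        = (\<Sum>j\<in>J \<inter> {0..}. (2 + \<bar>real_of_int j\<bar>) powr (- p)) + (\<Sum>j\<in>J - {0..}. (2 + \<bar>real_of_int j\<bar>) powr (- p))"
      using J by (rule sum.Int_Diff)
    also have "\<dots> \<le> suminf h + suminf h"
      by (intro add_mono half) (auto simp: inj_on_def)
    finally show "(\<Sum>j\<in>J. (2 + \<bar>real_of_int j\<bar>) powr (- p)) \<le> 2 * suminf h" by simp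
  qed
qed

section \<open>Separated nets and their multiplicity\<close>

context Metric_space
begin

definition separated :: "real \<Rightarrow> 'a set \<Rightarrow> bool" where
  "separated \<delta> S \<longleftrightarrow> S \<subseteq> M \<and> (\<forall>a\<in>S. \<forall>b\<in>S. a \<noteq> b \<longrightarrow> \<delta> \<le> d a b)"

text \<open>A point at distance at least \<open>\<delta>\<close> from every point of a maximal separated set could be added to it.\<close>

lemma maximal_separated_net:
  assumes "\<delta> > 0"
  shows "\<exists>S. separated \<delta> S \<and> (\<forall>x\<in>M. \<exists>a\<in>S. d x a < \<delta>)"
proof -
  have "\<exists>S\<in>Collect (separated \<delta>). \<forall>T\<in>Collect (separated \<delta>). S \<subseteq> T \<longrightarrow> T = S"
  proof (rule subset_Zorn')
    fix \<C> assume ch: "subset.chain (Collect (separated \<delta>)) \<C>"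
    have "\<delta> \<le> d a b" if ab: "a \<in> \<Union>\<C>" "b \<in> \<Union>\<C>" "a \<noteq> b" for a b
    proof -
      obtain S T where "S \<in> \<C>" "T \<in> \<C>" "a \<in> S" "b \<in> T" using ab by blast
      moreover have "S \<subseteq> T \<or> T \<subseteq> S"
        using ch calculation by (auto simp: subset_chain_def)
      moreover have "separated \<delta> S" "separated \<delta> T"
        using ch calculation by (auto simp: subset_chain_def)
      ultimately show ?thesis using \<open>a \<noteq> b\<close> unfolding separated_def by blast
    qed
    moreover have "\<Union>\<C> \<subseteq> M"
      using ch unfolding subset_chain_def separated_def by blast
    ultimately show "\<Union>\<C> \<in> Collect (separated \<delta>)" by (simp add: separated_def)
  qed
  then obtain S where S: "separated \<delta> S" and max: "\<And>T. separated \<delta> T \<Longrightarrow> S \<subseteq> T \<Longrightarrow> T = S"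
    by blast
  have "\<exists>a\<in>S. d x a < \<delta>" if "x \<in> M" for x
  proof (rule ccontr)
    assume far: "\<not> (\<exists>a\<in>S. d x a < \<delta>)"
    then have "separated \<delta> (insert x S)"
      using S that by (auto simp: separated_def commute not_less)
    then have "x \<in> S" using max[of "insert x S"] by blast
    then show False using far that assms by auto
  qed
  with S show ?thesis by blast
qed

text \<open>Since the real bound is finite, the infimum that defines \<open>cover_num\<close> is over a nonempty set and is
  attained; this gives actual covers.\<close>

lemma almost_homogeneous_cover:
  assumes "almost_homogeneous \<alpha> \<beta> K s" and "0 < \<rho>" and "\<rho> < r" and "x \<in> M"
  obtains C where "C \<subseteq> M" "finite C" "mball x r \<subseteq> (\<Union>c\<in>C. mball c \<rho>)"
    and "real (card C) \<le> K * (r / \<rho>) powr s * slog r powr \<beta> * slog \<rho> powr \<alpha>"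
proof -
  define P where "P n \<longleftrightarrow> (\<forall>x\<in>M. \<exists>C\<subseteq>M. finite C \<and> card C \<le> n \<and>
                                mball x r \<subseteq> (\<Union>c\<in>C. mball c \<rho>))" for n
  define A where "A = {enat n | n. P n}"
  have "cover_num r \<rho> = Inf A" by (simp only: cover_num_def A_def P_def)
  then have le: "ereal_of_enat (Inf A)
      \<le> ereal (K * (r / \<rho>) powr s * slog r powr \<beta> * slog \<rho> powr \<alpha>)"
    using assms(1-3) unfolding almost_homogeneous_def by metis
  have "Inf A \<noteq> \<infinity>"
  proof
    assume "Inf A = \<infinity>"
    with le show False by (simp only: ereal_of_enat_simps) simp
  qed
  then have "A \<noteq> {}" by (metis Inf_enat_def)
  then have "Inf A \<in> A" unfolding Inf_enat_def by (metis LeastI ex_in_conv)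
  then obtain n where n: "Inf A = enat n" and "P n"
    unfolding A_def by (elim CollectE exE conjE)
  then obtain C where C: "C \<subseteq> M" "finite C" "card C \<le> n" "mball x r \<subseteq> (\<Union>c\<in>C. mball c \<rho>)"
    using \<open>x \<in> M\<close> unfolding P_def by (elim ballE exE conjE) auto
  have "real n \<le> K * (r / \<rho>) powr s * slog r powr \<beta> * slog \<rho> powr \<alpha>"
    using le by (simp only: n ereal_of_enat_simps ereal_less_eq)
  with C(3) have "real (card C) \<le> K * (r / \<rho>) powr s * slog r powr \<beta> * slog \<rho> powr \<alpha>"
    by linarith
  with C(1,2,4) show ?thesis by (intro that[of C])
qed

text \<open>An open ball of radius \<open>\<delta> / 2\<close> has diameter at most \<open>\<delta>\<close>, never attained, so it contains at most one
  point of a \<open>\<delta>\<close>-separated set.\<close>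

lemma separated_card_le_cover:
  assumes S: "separated \<delta> S" and C: "finite C" "B \<subseteq> (\<Union>c\<in>C. mball c (\<delta> / 2))"
  shows "finite (S \<inter> B)" and "card (S \<inter> B) \<le> card C"
proof -
  have "\<forall>a\<in>S \<inter> B. \<exists>c. c \<in> C \<and> a \<in> mball c (\<delta> / 2)"
    using C(2) by blast
  from bchoice[OF this] obtain h
    where h: "\<And>a. a \<in> S \<inter> B \<Longrightarrow> h a \<in> C \<and> a \<in> mball (h a) (\<delta> / 2)"
    by blast
  have "inj_on h (S \<inter> B)"
  proof (rule inj_onI)
    fix a b assume a: "a \<in> S \<inter> B" and b: "b \<in> S \<inter> B" and eq: "h a = h b"
    have "d a b \<le> d (h a) a + d (h a) b"
      using h[OF a] h[OF b] triangle'[of a "h a" b] eq by (simp add: commute)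
    also have "\<dots> < \<delta>"
      using h[OF a] h[OF b] eq by auto
    finally show "a = b"
      using S a b unfolding separated_def by force
  qed
  moreover have "h ` (S \<inter> B) \<subseteq> C" using h by blast
  ultimately show "finite (S \<inter> B)" "card (S \<inter> B) \<le> card C"
    using C(1) by (auto intro: inj_on_finite card_inj_on_le)
qed

text \<open>Each of the balls around a fixed point contains finitely many points of the set, and countably
  many such balls exhaust the space. The radii \<open>\<delta> + n\<close> exceed \<open>\<delta> / 2\<close>, as the covering bound requires
  of the larger radius.\<close>

lemma countable_separated:
  assumes hom: "almost_homogeneous \<alpha> \<beta> K s" and S: "separated \<delta> S" and "\<delta> > 0"
  shows "countable S"
proof (cases "M = {}")
  case True
  moreover have "S \<subseteq> M" using S by (simp add: separated_def)
  ultimately show ?thesis by simp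
next
  case False
  then obtain x where x: "x \<in> M" by blast
  have "finite (S \<inter> mball x (\<delta> + real n))" for n
  proof -
    have "0 < \<delta> / 2" "\<delta> / 2 < \<delta> + real n" using \<open>\<delta> > 0\<close> by auto
    then obtain C where "finite C" "mball x (\<delta> + real n) \<subseteq> (\<Union>c\<in>C. mball c (\<delta> / 2))"
      by (rule almost_homogeneous_cover[OF hom _ _ x])
    then show ?thesis using separated_card_le_cover(1)[OF S] by blast
  qed
  then have "countable (\<Union>n. S \<inter> mball x (\<delta> + real n))"
    by (intro countable_UN) (auto intro: countable_finite)
  moreover have "S \<subseteq> (\<Union>n. S \<inter> mball x (\<delta> + real n))"
  proof
    fix a assume "a \<in> S"
    moreover obtain n where "d x a < real n" using reals_Archimedean2 by blast
    ultimately show "a \<in> (\<Union>n. S \<inter> mball x (\<delta> + real n))"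
      using S x \<open>\<delta> > 0\<close> by (auto simp: separated_def intro!: exI[of _ n])
  qed
  ultimately show ?thesis using countable_subset by blast
qed

text \<open>This is where the homogeneity exponents become powers of \<open>2 + \<bar>j\<bar>\<close>. The radii \<open>2 * 2\<^sup>j\<close> and
  \<open>2\<^sup>j / 2\<close> have the fixed ratio 4, so the factor with exponent \<open>s\<close> is constant, and both symmetric
  logarithms are at most \<open>2 + \<bar>j\<bar>\<close>.\<close>

lemma dyadic_net_multiplicity:
  fixes j :: int
  assumes hom: "almost_homogeneous \<alpha> \<beta> K s" and "\<alpha> \<ge> 0" "\<beta> \<ge> 0" "K \<ge> 0"
    and S: "separated (2 powr j) S" and x: "x \<in> M"
  shows "finite (S \<inter> mball x (2 * 2 powr j))"
    and "card (S \<inter> mball x (2 * 2 powr j)) \<le> K * 4 powr s * (2 + \<bar>real_of_int j\<bar>) powr (\<alpha> + \<beta>)"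
proof -
  define \<rho> :: real where "\<rho> = 2 powr j"
  have "0 < \<rho> / 2" "\<rho> / 2 < 2 * \<rho>" by (simp_all add: \<rho>_def)
  then obtain C where C: "finite C" "mball x (2 * \<rho>) \<subseteq> (\<Union>c\<in>C. mball c (\<rho> / 2))"
    and cardC: "card C \<le> K * (2 * \<rho> / (\<rho> / 2)) powr s * slog (2 * \<rho>) powr \<beta> * slog (\<rho> / 2) powr \<alpha>"
    by (rule almost_homogeneous_cover[OF hom _ _ x])
  note S' = S[folded \<rho>_def]
  show "finite (S \<inter> mball x (2 * 2 powr j))"
    using separated_card_le_cover(1)[OF S' C] by (simp only: \<rho>_def)
  have "2 * \<rho> = 2 powr (1 + real_of_int j)" "\<rho> / 2 = 2 powr (real_of_int j - 1)"
    unfolding \<rho>_def powr_add powr_diff by simp_all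
  then have "slog (2 * \<rho>) \<le> 1 + \<bar>1 + real_of_int j\<bar>" "slog (\<rho> / 2) \<le> 1 + \<bar>real_of_int j - 1\<bar>"
    by (simp_all only: slog_two_powr_le)
  then have "slog (2 * \<rho>) \<le> 2 + \<bar>real_of_int j\<bar>" "slog (\<rho> / 2) \<le> 2 + \<bar>real_of_int j\<bar>"
    by linarith+
  moreover have "0 \<le> slog (2 * \<rho>)" "0 \<le> slog (\<rho> / 2)"
    using slog_lower_bounds(2)[of "2 * \<rho>"] slog_lower_bounds(2)[of "\<rho> / 2"] \<open>0 < \<rho> / 2\<close>
    by linarith+
  ultimately have le: "slog (2 * \<rho>) powr \<beta> \<le> (2 + \<bar>real_of_int j\<bar>) powr \<beta>"
      "slog (\<rho> / 2) powr \<alpha> \<le> (2 + \<bar>real_of_int j\<bar>) powr \<alpha>"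
    using \<open>\<alpha> \<ge> 0\<close> \<open>\<beta> \<ge> 0\<close> by (simp_all only: powr_mono2)
  have ratio: "2 * \<rho> / (\<rho> / 2) = 4" using \<open>0 < \<rho> / 2\<close> by simp
  have "card (S \<inter> mball x (2 * \<rho>)) \<le> real (card C)"
    using separated_card_le_cover(2)[OF S' C] by simp
  also note cardC
  also have "K * (2 * \<rho> / (\<rho> / 2)) powr s * slog (2 * \<rho>) powr \<beta> * slog (\<rho> / 2) powr \<alpha>
      \<le> K * 4 powr s * (2 + \<bar>real_of_int j\<bar>) powr \<beta> * (2 + \<bar>real_of_int j\<bar>) powr \<alpha>"
    unfolding ratio using \<open>K \<ge> 0\<close> by (intro mult_mono le) auto
  also have "\<dots> = K * 4 powr s * (2 + \<bar>real_of_int j\<bar>) powr (\<alpha> + \<beta>)"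
    unfolding powr_add by (simp only: mult_ac)
  finally show "card (S \<inter> mball x (2 * 2 powr j)) \<le> K * 4 powr s * (2 + \<bar>real_of_int j\<bar>) powr (\<alpha> + \<beta>)"
    by (simp only: \<rho>_def)
qed

section \<open>Tent functions\<close>

definition tent :: "real \<Rightarrow> 'a \<Rightarrow> 'a \<Rightarrow> real" where
  "tent r a x = max 0 (r - d x a)"

lemma tent_lipschitz:
  assumes "a \<in> M" "x \<in> M" "y \<in> M"
  shows "\<bar>tent r a x - tent r a y\<bar> \<le> d x y"
  using triangle[of x y a] triangle[of y x a] assms by (auto simp: tent_def commute)

text \<open>Only net points within \<open>r\<close> of \<open>x\<close> or of \<open>y\<close> give a nonzero difference; there are at most \<open>2 * m\<close> of
  them, and each difference is at most \<open>d x y\<close>.\<close>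

lemma sum_tent_differences_le:
  fixes m :: real
  assumes S: "S \<subseteq> M" and A: "finite A" "A \<subseteq> S" and x: "x \<in> M" and y: "y \<in> M"
    and mult: "\<And>z. z \<in> M \<Longrightarrow> finite (S \<inter> mball z r) \<and> card (S \<inter> mball z r) \<le> m"
  shows "(\<Sum>a\<in>A. (tent r a x - tent r a y)\<^sup>2) \<le> 2 * m * (d x y)\<^sup>2"
proof -
  define T where "T = (S \<inter> mball x r) \<union> (S \<inter> mball y r)"
  have finT: "finite T" using mult x y by (simp add: T_def)
  have "real (card T) \<le> real (card (S \<inter> mball x r)) + card (S \<inter> mball y r)"
    unfolding T_def using card_Un_le of_nat_mono by (metis of_nat_add)
  also have "\<dots> \<le> 2 * m"
    using mult[OF x] mult[OF y] by simp
  finally have cardT: "card T \<le> 2 * m" .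
  have "(\<Sum>a\<in>A. (tent r a x - tent r a y)\<^sup>2) = (\<Sum>a\<in>A \<inter> T. (tent r a x - tent r a y)\<^sup>2)"
    using A S x y by (intro sum.mono_neutral_right) (auto simp: T_def tent_def)
  also have "\<dots> \<le> (\<Sum>a\<in>A \<inter> T. (d x y)\<^sup>2)"
  proof (rule sum_mono)
    fix a assume "a \<in> A \<inter> T"
    then have "\<bar>tent r a x - tent r a y\<bar> \<le> d x y"
      using tent_lipschitz[of a x y r] A S x y by blast
    then show "(tent r a x - tent r a y)\<^sup>2 \<le> (d x y)\<^sup>2"
      by (metis abs_ge_zero power2_abs power_mono)
  qed
  also have "\<dots> \<le> card T * (d x y)\<^sup>2"
    using finT by (simp add: mult_right_mono card_mono)
  also have "\<dots> \<le> 2 * m * (d x y)\<^sup>2"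
    using cardT by (rule mult_right_mono) simp
  finally show ?thesis .
qed

section \<open>The almost bi-Lipschitz embedding\<close>

lemma almost_bi_lipschitz_embedding:
  fixes \<alpha> \<beta> \<gamma> K s :: real
  assumes hom: "almost_homogeneous \<alpha> \<beta> K s" and "\<alpha> \<ge> 0" "\<beta> \<ge> 0" "K \<ge> 0"
    and "infinite_dimensional TYPE('h::{real_inner, complete_space})"
    and "\<gamma> > \<alpha> + \<beta> + 1 / 2"
  shows "\<exists>(f :: 'a \<Rightarrow> 'h::{real_inner, complete_space}) L. L > 0 \<and>
           (\<forall>x\<in>M. \<forall>y\<in>M. x \<noteq> y \<longrightarrow>
              1 / L * (d x y / slog (d x y) powr \<gamma>) \<le> norm (f x - f y) \<and>
              norm (f x - f y) \<le> L * d x y)"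
proof -
  have "\<gamma> > 0" using \<open>\<alpha> \<ge> 0\<close> \<open>\<beta> \<ge> 0\<close> \<open>\<gamma> > \<alpha> + \<beta> + 1 / 2\<close> by linarith
  have "\<forall>j::int. \<exists>S. separated (2 powr j) S \<and> (\<forall>x\<in>M. \<exists>a\<in>S. d x a < 2 powr j)"
    by (intro allI maximal_separated_net) simp
  then obtain N :: "int \<Rightarrow> 'a set" where N: "\<And>j. separated (2 powr j) (N j)"
    and dense: "\<And>j x. x \<in> M \<Longrightarrow> \<exists>a\<in>N j. d x a < 2 powr j"
    by metis
  have N_subset: "N j \<subseteq> M" for j using N by (simp add: separated_def)
  define I where "I = (SIGMA j:UNIV. N j)"
  have "countable I"
    unfolding I_def by (intro countable_SIGMA countableI_type countable_separated[OF hom N]) simp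
  define \<rho> where "\<rho> j = 2 powr real_of_int j" for j
  define w where "w j = (2 + \<bar>real_of_int j\<bar>) powr (- \<gamma>)" for j :: int
  define g where "g = (\<lambda>(j, a) x. w j * tent (2 * \<rho> j) a x)"
  have "2 * \<gamma> - \<alpha> - \<beta> > 1"
    using \<open>\<alpha> \<ge> 0\<close> \<open>\<beta> \<ge> 0\<close> \<open>\<gamma> > \<alpha> + \<beta> + 1 / 2\<close> by linarith
  from sum_int_powr_bounded[OF this] obtain B
    where B: "\<And>J :: int set. finite J \<Longrightarrow> (\<Sum>j\<in>J. (2 + \<bar>real_of_int j\<bar>) powr (- (2 * \<gamma> - \<alpha> - \<beta>))) \<le> B"
    by blast
  define L1 where "L1 = 2 * K * 4 powr s * B"
  \<comment> \<open>Sort the coordinates by scale. At scale \<open>j\<close> the squared weight, times the multiplicity of the net,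
    is a constant multiple of a term of the convergent series bounded by \<open>B\<close>.\<close>
  have energy: "(\<Sum>i\<in>F. (g i x - g i y)\<^sup>2) \<le> L1 * (d x y)\<^sup>2"
    if "x \<in> M" "y \<in> M" "finite F" "F \<subseteq> I" for x y :: 'a and F :: "(int \<times> 'a) set"
  proof -
    let ?A = "\<lambda>j::int. F `` {j}"
    have finA: "finite (?A j)" for j using \<open>finite F\<close> by (rule finite_Image)
    have "i \<in> F \<longleftrightarrow> i \<in> (SIGMA j:fst ` F. ?A j)" for i
      by (cases i) (auto intro: rev_image_eqI)
    then have "F = (SIGMA j:fst ` F. ?A j)" by blast
    then have "(\<Sum>i\<in>F. (g i x - g i y)\<^sup>2) = (\<Sum>i\<in>(SIGMA j:fst ` F. ?A j). (g i x - g i y)\<^sup>2)"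
      by (rule arg_cong)
    also have "\<dots> = (\<Sum>j\<in>fst ` F. \<Sum>a\<in>?A j. (g (j, a) x - g (j, a) y)\<^sup>2)"
      using \<open>finite F\<close> finA by (subst sum.Sigma) auto
    also have "\<dots> \<le> (\<Sum>j\<in>fst ` F. 2 * K * 4 powr s * (d x y)\<^sup>2
                              * (2 + \<bar>real_of_int j\<bar>) powr (- (2 * \<gamma> - \<alpha> - \<beta>)))"
    proof (rule sum_mono)
      fix j :: int
      let ?m = "K * 4 powr s * (2 + \<bar>real_of_int j\<bar>) powr (\<alpha> + \<beta>)"
      have weight: "(w j)\<^sup>2 * (2 + \<bar>real_of_int j\<bar>) powr (\<alpha> + \<beta>)
          = (2 + \<bar>real_of_int j\<bar>) powr (- (2 * \<gamma> - \<alpha> - \<beta>))"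
        unfolding w_def power2_eq_square powr_add[symmetric] by (simp add: algebra_simps)
      have "g (j, a) x - g (j, a) y = w j * (tent (2 * \<rho> j) a x - tent (2 * \<rho> j) a y)" for a
        by (simp add: g_def right_diff_distrib)
      then have "(\<Sum>a\<in>?A j. (g (j, a) x - g (j, a) y)\<^sup>2)
          = (w j)\<^sup>2 * (\<Sum>a\<in>?A j. (tent (2 * \<rho> j) a x - tent (2 * \<rho> j) a y)\<^sup>2)"
        by (simp only: sum_distrib_left power_mult_distrib)
      also have "\<dots> \<le> (w j)\<^sup>2 * (2 * ?m * (d x y)\<^sup>2)"
      proof (intro mult_left_mono sum_tent_differences_le[OF N_subset[of j] finA])
        show "?A j \<subseteq> N j" using \<open>F \<subseteq> I\<close> by (auto simp: I_def)
        show "finite (N j \<inter> mball z (2 * \<rho> j)) \<and> card (N j \<inter> mball z (2 * \<rho> j)) \<le> ?m"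
          if "z \<in> M" for z
          using dyadic_net_multiplicity[OF hom \<open>\<alpha> \<ge> 0\<close> \<open>\<beta> \<ge> 0\<close> \<open>K \<ge> 0\<close> N that]
          unfolding \<rho>_def by blast
      qed (use \<open>x \<in> M\<close> \<open>y \<in> M\<close> in simp_all)
      also have "\<dots> = 2 * K * 4 powr s * (d x y)\<^sup>2 * ((w j)\<^sup>2 * (2 + \<bar>real_of_int j\<bar>) powr (\<alpha> + \<beta>))"
        by (simp only: mult_ac)
      also have "\<dots> = 2 * K * 4 powr s * (d x y)\<^sup>2 * (2 + \<bar>real_of_int j\<bar>) powr (- (2 * \<gamma> - \<alpha> - \<beta>))"
        by (simp only: weight)
      finally show "(\<Sum>a\<in>?A j. (g (j, a) x - g (j, a) y)\<^sup>2)
          \<le> 2 * K * 4 powr s * (d x y)\<^sup>2 * (2 + \<bar>real_of_int j\<bar>) powr (- (2 * \<gamma> - \<alpha> - \<beta>))" .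
    qed
    also have "\<dots> = 2 * K * 4 powr s * (d x y)\<^sup>2
                      * (\<Sum>j\<in>fst ` F. (2 + \<bar>real_of_int j\<bar>) powr (- (2 * \<gamma> - \<alpha> - \<beta>)))"
      by (simp add: sum_distrib_left)
    also have "\<dots> \<le> 2 * K * 4 powr s * (d x y)\<^sup>2 * B"
      using \<open>K \<ge> 0\<close> \<open>finite F\<close> by (intro mult_left_mono B) auto
    finally show ?thesis by (simp add: L1_def mult_ac)
  qed
  have "\<exists>f :: 'a \<Rightarrow> 'h. \<forall>x\<in>M. \<forall>y\<in>M. (norm (f x - f y))\<^sup>2 \<le> L1 * (d x y)\<^sup>2 \<and>
           (\<forall>i\<in>I. \<bar>g i x - g i y\<bar> \<le> norm (f x - f y))"
    using \<open>infinite_dimensional TYPE('h)\<close> \<open>countable I\<close> energy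
    by (rule hilbert_embedding_from_coordinates)
  then obtain f :: "'a \<Rightarrow> 'h" where f: "\<forall>x\<in>M. \<forall>y\<in>M. (norm (f x - f y))\<^sup>2 \<le> L1 * (d x y)\<^sup>2 \<and>
           (\<forall>i\<in>I. \<bar>g i x - g i y\<bar> \<le> norm (f x - f y))" ..
  then have upper: "(norm (f x - f y))\<^sup>2 \<le> L1 * (d x y)\<^sup>2" if "x \<in> M" "y \<in> M" for x y
    using that by simp
  have coord: "\<bar>g i x - g i y\<bar> \<le> norm (f x - f y)" if "x \<in> M" "y \<in> M" "i \<in> I" for x y i
    using f that by simp
  \<comment> \<open>The 8 compensates \<open>d x y < 8 * \<rho> j\<close>, the other factor \<open>2 + \<bar>j\<bar> \<le> 6 / ln 2 * slog (d x y)\<close>.\<close>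
  define L2 where "L2 = 8 * (6 / ln 2) powr \<gamma>"
  have "L2 > 0" by (simp add: L2_def)
  define L where "L = max (sqrt L1) L2"
  have "1 / L * (d x y / slog (d x y) powr \<gamma>) \<le> norm (f x - f y)"
    and "norm (f x - f y) \<le> L * d x y" if xy: "x \<in> M" "y \<in> M" "x \<noteq> y" for x y
  proof -
    have "norm (f x - f y) \<le> sqrt (L1 * (d x y)\<^sup>2)"
      using upper[OF xy(1,2)] by (rule real_le_rsqrt)
    also have "\<dots> = sqrt L1 * d x y" by (simp add: real_sqrt_mult)
    also have "\<dots> \<le> L * d x y" by (intro mult_right_mono) (auto simp: L_def)
    finally show "norm (f x - f y) \<le> L * d x y" .
    have "d x y > 0" using xy by simp
    then obtain j :: int where j: "4 * \<rho> j \<le> d x y" "d x y < 8 * \<rho> j"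
      "2 + \<bar>real_of_int j\<bar> \<le> 6 / ln 2 * slog (d x y)"
      unfolding \<rho>_def by (rule dyadic_scale)
    have sl: "slog (d x y) > 0"
      using slog_lower_bounds(1)[OF \<open>d x y > 0\<close>] ln_gt_zero[of "2::real"] by linarith
    \<comment> \<open>The tent of a net point near \<open>x\<close> at the scale of \<open>d x y\<close> separates \<open>x\<close> from \<open>y\<close>.\<close>
    obtain a where a: "a \<in> N j" "d x a < \<rho> j" using dense[of x j] xy unfolding \<rho>_def by blast
    have aX: "a \<in> M" using a N_subset by blast
    have "d x y \<le> d x a + d y a"
      using triangle[of x a y] xy aX by (simp only: commute)
    then have "tent (2 * \<rho> j) a y = 0"
      using j a by (simp add: tent_def)
    moreover have "\<rho> j \<le> tent (2 * \<rho> j) a x"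
      using a by (simp add: tent_def)
    ultimately have "w j * \<rho> j \<le> \<bar>g (j, a) x - g (j, a) y\<bar>"
      by (simp add: g_def abs_mult w_def mult_left_mono)
    also have "\<dots> \<le> norm (f x - f y)"
      using a xy by (intro coord) (auto simp: I_def)
    finally have low: "w j * \<rho> j \<le> norm (f x - f y)" .
    have "1 / L * (d x y / slog (d x y) powr \<gamma>) \<le> 1 / L2 * (d x y / slog (d x y) powr \<gamma>)"
      using \<open>L2 > 0\<close> \<open>d x y > 0\<close> by (intro mult_right_mono divide_left_mono) (auto simp: L_def)
    also have "\<dots> = (6 / ln 2 * slog (d x y)) powr (- \<gamma>) * (d x y / 8)"
      using sl unfolding L2_def powr_minus_divide by (subst powr_mult) simp_all
    also have "\<dots> \<le> w j * \<rho> j"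
    proof (rule mult_mono)
      show "(6 / ln 2 * slog (d x y)) powr (- \<gamma>) \<le> w j"
        unfolding w_def using j(3) \<open>\<gamma> > 0\<close> by (intro powr_mono2') auto
    qed (use j \<open>d x y > 0\<close> in \<open>simp_all add: w_def\<close>)
    also note low
    finally show "1 / L * (d x y / slog (d x y) powr \<gamma>) \<le> norm (f x - f y)" .
  qed
  moreover have "L > 0" using \<open>L2 > 0\<close> by (simp add: L_def)
  ultimately show ?thesis by blast
qed

end

theorem theorem2p3:
  fixes X :: "'a set" and d :: "'a \<Rightarrow> 'a \<Rightarrow> real"
    and \<alpha> \<beta> M s \<gamma> :: real
  assumes "\<alpha> \<ge> 0" and "\<beta> \<ge> 0" and "M \<ge> 1" and "s \<ge> 0"
    and "Metric_space X d"
    and "Metric_space.almost_homogeneous X d \<alpha> \<beta> M s"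
    and "infinite_dimensional TYPE('h::{real_inner, complete_space})"
    and "separable_space (euclidean :: 'h topology)"
    and "\<gamma> > \<alpha> + \<beta> + 1 / 2"
  shows "\<exists>(f :: 'a \<Rightarrow> 'h) L. L > 0 \<and>
           (\<forall>x\<in>X. \<forall>y\<in>X. x \<noteq> y \<longrightarrow>
              1 / L * (d x y / slog (d x y) powr \<gamma>) \<le> norm (f x - f y) \<and>
              norm (f x - f y) \<le> L * d x y)"
proof -
  have "0 \<le> M" using \<open>M \<ge> 1\<close> by simp
  then show ?thesis
    by (rule Metric_space.almost_bi_lipschitz_embedding[OF assms(5,6,1,2) _ assms(7,9)])
qed

end
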